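(* Let $A$ be a uniformly random subset of $\mathbb{Z}_N$ (each of the $2^N$ subsets being equally likely), and let $\omega(G_A)$ be the clique number of the Cayley sum graph $G_A$. Then $$\lim_{N\to\infty}\mathbb{P}\left(\omega(G_A)\le 160\log N\right)=1.$$
   Context: $\mathbb{Z}_N=\mathbb{Z}/N\mathbb{Z}$. For a finite abelian group $\Gamma$ and $A\subseteq\Gamma$, the Cayley sum graph $G_A$ is the (simple) graph on vertex set $\Gamma$ in which distinct $i,j$ are joined by an edge precisely when $i+j\in A$. The clique number $\omega$ is the largest number of vertices in a complete subgraph. All logarithms are to base 2. *)

theory Defs
  imports "HOL-Library.Ramsey" "HOL-Algebra.Elementary_Groups" "HOL-Probability.Probability"
begin

text \<open>
  A simple graph is given by a vertex set and a set of two-element edges. The group is written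
  multiplicatively in the library, so the sum of \<open>i\<close> and \<open>j\<close> is \<open>i \<otimes>\<^bsub>G\<^esub> j\<close>.
\<close>

definition cayley_sum_edges :: "('a, 'b) monoid_scheme \<Rightarrow> 'a set \<Rightarrow> 'a set set" where
  "cayley_sum_edges G A =
     {{i, j} | i j. i \<in> carrier G \<and> j \<in> carrier G \<and> i \<noteq> j \<and> i \<otimes>\<^bsub>G\<^esub> j \<in> A}"

text \<open>Meaningful for finite \<open>V\<close>; \<^const>\<open>Max\<close> is unspecified on infinite sets.\<close>

definition clique_number :: "'a set \<Rightarrow> 'a set set \<Rightarrow> nat" where
  "clique_number V E = Max (card ` {S. S \<subseteq> V \<and> clique S E})"

definition cayley_sum_clique_number :: "('a, 'b) monoid_scheme \<Rightarrow> 'a set \<Rightarrow> nat" where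
  "cayley_sum_clique_number G A = clique_number (carrier G) (cayley_sum_edges G A)"

text \<open>
  The group \<^term>\<open>integer_mod_group N\<close> has carrier \<open>{0..<int N}\<close> for \<open>N > 0\<close>, but it is the infinite
  group of integers for \<open>N = 0\<close>, where this distribution is unspecified.
\<close>

definition random_subset_mod :: "nat \<Rightarrow> int set pmf" where
  "random_subset_mod N = pmf_of_set (Pow (carrier (integer_mod_group N)))"

end

theory Submission
  imports Defs "HOL-Real_Asymp.Real_Asymp"
begin

text \<open>
  Write \<open>L = log 2 N\<close>, and for a finite set \<open>Y\<close> of naturals let \<open>T Y\<close> be the set of sums of two
  distinct elements of \<open>Y\<close>. If the residues of \<open>Y\<close> form a clique of the Cayley sum graph of \<open>A\<close>, then
  \<open>A\<close> contains \<open>T Y\<close> modulo \<open>N\<close>, which has probability \<open>2\<close> to the minus number of residues of \<open>T Y\<close>.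
  A union bound over all \<open>160 L\<close>-element sets fails, because too many of them may have few sums.
  Instead every large clique is shown to contain a small set \<open>Y\<close> with many sums, and sets with a
  given number of sums are counted.

  Of more than \<open>160 L\<close> clique members, more than \<open>80 L\<close> lie in one half of \<open>{0..<N}\<close>. Inside one
  half, reduction modulo \<open>N\<close> is injective on sums, so that one can work in the ordered semigroup of
  naturals. A set of \<open>n\<close> naturals has at least \<open>2 n - 3\<close> sums of distinct elements, and almost as
  many already come from a much smaller subset: \<open>sparse_subset_many_sums\<close> finds a
  subset \<open>Y\<close> with about \<open>10 L\<close> elements and at least \<open>1.9 * 80 L = 152 L\<close> sums.

  The heart of the proof is \<open>card_sets_few_distinct_sums\<close>: the number of \<open>q\<close>-element sets
  \<open>Y \<subseteq> {..<N}\<close> with \<open>M\<close> sums is at most about \<open>N\<close> to the power \<open>1 + 14 M / (3 q)\<close>, times the number of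
  subsets of a \<open>5 M\<close>-element set with at most \<open>q\<close> elements. The first factor reflects that a set of
  integers with \<open>M\<close> sums is generated by \<open>O(M / q)\<close> of its elements (a substitute for Freiman's
  lemma), the second that everything else is a choice among few possibilities.
  To see this, call a sum \<open>z + y\<close> with \<open>y < z\<close> in \<open>Y\<close> fresh at \<open>z\<close> if it is not a sum of two distinct
  elements below \<open>z\<close>. Every sum is fresh at most once, so some pivot \<open>x\<close> in the upper half of \<open>Y\<close>
  has at most \<open>2 M / q\<close> fresh sums. Reveal \<open>Y\<close> by walking down from \<open>x\<close> and then up from \<open>x\<close>.

  \<^item> On the way down, let a position \<open>w\<close> be predicted if \<open>w + x = a + b\<close> for distinct elements \<open>a\<close>, \<open>b\<close>
    of \<open>Y\<close> strictly between \<open>w\<close> and \<open>x\<close>. An element \<open>y < x\<close> of \<open>Y\<close> whose sum with \<open>x\<close> is not fresh is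
    predicted: if \<open>y + x = a + b\<close> with \<open>a\<close>, \<open>b\<close> below \<open>x\<close>, then \<open>a\<close>, \<open>b\<close> exceed \<open>y\<close>. This is where the
    order of the integers enters; a large subspace over a finite field has few sums, yet it has no
    generating set of bounded size.
  \<^item> On the way up, let \<open>w\<close> be predicted if for more than a quarter of the elements \<open>y \<le> x\<close> of \<open>Y\<close> the sum
    \<open>w + y\<close> is a sum of distinct elements below \<open>w\<close>. An element of \<open>Y\<close> that is not predicted has at
    least \<open>3 q / 8\<close> fresh sums, so there are at most \<open>8 M / (3 q)\<close> of those.

  Only \<open>5 M\<close> positions are ever predicted. So \<open>Y\<close> is determined by \<open>x\<close>, by its at most \<open>14 M / (3 q)\<close>
  other unpredicted elements, and by one bit for each predicted position.

  With \<open>q\<close> about \<open>10 L\<close> the logarithm of this number is at most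
  \<open>L + 7 M / 15 + 6 q + 5 M / 44\<close>, which for \<open>M \<ge> 152 L\<close> is less than \<open>M - 2 L + O(1)\<close>. The expected
  number of sets \<open>Y\<close> with \<open>M\<close> sums contained in \<open>A\<close> is thus \<open>O(1 / N\<^sup>2)\<close>, and only \<open>O(L\<^sup>2)\<close> values
  of \<open>M\<close> occur.
\<close>

section \<open>Sums of distinct elements\<close>

definition distinct_sums :: "nat set \<Rightarrow> nat set" where
  "distinct_sums Y = {a + b | a b. a \<in> Y \<and> b \<in> Y \<and> a \<noteq> b}"

lemma distinct_sumsI: "a \<in> Y \<Longrightarrow> b \<in> Y \<Longrightarrow> a \<noteq> b \<Longrightarrow> a + b \<in> distinct_sums Y"
  by (auto simp: distinct_sums_def)

lemma distinct_sums_mono: "Y \<subseteq> Z \<Longrightarrow> distinct_sums Y \<subseteq> distinct_sums Z"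
  by (auto simp: distinct_sums_def)

lemma distinct_sums_subset_image: "distinct_sums Y \<subseteq> (\<lambda>(a, b). a + b) ` (Y \<times> Y)"
  by (auto simp: distinct_sums_def)

lemma finite_distinct_sums: "finite Y \<Longrightarrow> finite (distinct_sums Y)"
  by (rule finite_subset[OF distinct_sums_subset_image]) simp

lemma card_distinct_sums_le:
  assumes "finite Y"
  shows "card (distinct_sums Y) \<le> card Y ^ 2"
proof -
  have "card (distinct_sums Y) \<le> card ((\<lambda>(a, b). a + b) ` (Y \<times> Y))"
    using assms by (intro card_mono[OF _ distinct_sums_subset_image]) simp
  also have "\<dots> \<le> card (Y \<times> Y)" using assms by (intro card_image_le) simp
  finally show ?thesis by (simp add: card_cartesian_product power2_eq_square)
qed

lemma initial_segment_exists:
  fixes X :: "'a::linorder set"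
  assumes "finite X" "s \<le> card X"
  shows "\<exists>L \<subseteq> X. card L = s \<and> (\<forall>l\<in>L. \<forall>z\<in>X - L. l < z)"
  using assms(2)
proof (induction s)
  case 0
  then show ?case by (intro exI[of _ "{}"]) auto
next
  case (Suc s)
  then obtain L where L: "L \<subseteq> X" "card L = s" "\<forall>l\<in>L. \<forall>z\<in>X - L. l < z" by auto
  have fin: "finite L" "finite (X - L)" using L(1) assms(1) finite_subset by auto
  have ne: "X - L \<noteq> {}" using L Suc.prems fin card_mono[of L X] by force
  define m where "m = Min (X - L)"
  have m: "m \<in> X - L" and min: "\<And>z. z \<in> X - L \<Longrightarrow> m \<le> z"
    using Min_in[OF fin(2) ne] Min_le[OF fin(2)] by (auto simp: m_def)
  have "\<forall>l\<in>insert m L. \<forall>z\<in>X - insert m L. l < z"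
    using L(3) min by (fastforce simp: order.strict_iff_order)
  then show ?case
    using m L fin by (intro exI[of _ "insert m L"]) auto
qed

section \<open>Sparse subsets with many sums\<close>

text \<open>
  Translates of \<open>C\<close> by elements of \<open>Z\<close> are added one at a time. As long as fewer than \<open>v\<close> sums are
  present, each \<open>c \<in> C\<close> has its sum with a random \<open>y \<in> Z\<close> already present with probability less than
  \<open>v / card Z\<close>, so an average \<open>y\<close> contributes at least \<open>card C * (1 - v / card Z) - 1\<close> new sums, the last
  term accounting for the forbidden sum \<open>y + y\<close>.
\<close>

lemma greedy_translates:
  fixes C Z :: "nat set"
  assumes fin: "finite C" "finite Z" and ne: "Z \<noteq> {}"
    and bound: "(r + 1) * card Z + card C * v \<le> card C * card Z"
  shows "\<exists>B \<subseteq> Z. card B \<le> t \<and> min (t * r) v \<le> card {b + c | b c. b \<in> B \<and> c \<in> C \<and> b \<noteq> c}"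
proof (induction t)
  case 0
  then show ?case by (intro exI[of _ "{}"]) auto
next
  case (Suc t)
  define S where "S = (\<lambda>B. {b + c | b c. b \<in> B \<and> c \<in> C \<and> b \<noteq> c})"
  have finS: "finite (S B)" if "B \<subseteq> Z" for B
  proof -
    have "S B \<subseteq> (\<lambda>(b, c). b + c) ` (B \<times> C)" by (auto simp: S_def)
    then show ?thesis using that fin finite_subset[of B Z]
      by (meson finite_SigmaI finite_imageI finite_subset)
  qed
  from Suc obtain B where B: "B \<subseteq> Z" "card B \<le> t" "min (t * r) v \<le> card (S B)"
    by (auto simp: S_def)
  have finB: "finite B" using B(1) fin(2) finite_subset by blast
  show ?case
  proof (cases "v \<le> card (S B)")
    case True
    then show ?thesis using B unfolding S_def by (intro exI[of _ B]) auto
  next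
    case False
    define h where "h = (\<lambda>y. card {c\<in>C. y + c \<in> S B})"
    \<comment> \<open>each \<open>c\<close> and each present sum determine \<open>y\<close>, so few pairs \<open>(y, c)\<close> have a present sum\<close>
    have "(\<Sum>y\<in>Z. h y) = (\<Sum>y\<in>Z. \<Sum>c\<in>C. if y + c \<in> S B then 1 else 0)"
      using fin by (simp add: h_def sum.If_cases Int_def)
    also have "\<dots> = (\<Sum>c\<in>C. \<Sum>y\<in>Z. if y + c \<in> S B then 1 else 0)" by (rule sum.swap)
    also have "\<dots> = (\<Sum>c\<in>C. card {y\<in>Z. y + c \<in> S B})"
      using fin by (simp add: sum.If_cases Int_def)
    also have "\<dots> \<le> (\<Sum>c\<in>C. card (S B))"
    proof (rule sum_mono)
      fix c
      show "card {y\<in>Z. y + c \<in> S B} \<le> card (S B)"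
        by (rule card_inj_on_le[where f="\<lambda>y. y + c"]) (use finS B in \<open>auto simp: inj_on_def\<close>)
    qed
    also have "\<dots> \<le> card C * v" using False by simp
    finally have tot: "(\<Sum>y\<in>Z. h y) \<le> card C * v" .
    have "\<exists>y\<in>Z. h y + (r + 1) \<le> card C"
    proof (rule ccontr)
      assume "\<not> ?thesis"
      then have "\<And>y. y \<in> Z \<Longrightarrow> card C < h y + (r + 1)" by auto
      then have "(\<Sum>y\<in>Z. card C) < (\<Sum>y\<in>Z. h y + (r + 1))"
        using fin ne by (intro sum_strict_mono) auto
      also have "\<dots> = (\<Sum>y\<in>Z. h y) + card Z * (r + 1)"
        by (subst sum.distrib) simp
      finally show False using tot bound by (simp add: algebra_simps)
    qed
    then obtain y where y: "y \<in> Z" "h y + (r + 1) \<le> card C" by blast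
    define D where "D = {c\<in>C. y + c \<notin> S B \<and> c \<noteq> y}"
    have "card C \<le> card (insert y (D \<union> {c\<in>C. y + c \<in> S B}))"
      using fin by (intro card_mono) (auto simp: D_def)
    also have "\<dots> \<le> Suc (card (D \<union> {c\<in>C. y + c \<in> S B}))" using fin by (simp add: card_insert_if D_def)
    also have "\<dots> \<le> Suc (card D + h y)" unfolding h_def by (intro Suc_le_mono[THEN iffD2] card_Un_le)
    finally have D: "r \<le> card D" using y(2) by simp
    have sub: "S B \<union> (+) y ` D \<subseteq> S (insert y B)" by (auto simp: S_def D_def)
    have "card (S B) + card D = card (S B \<union> (+) y ` D)"
      using fin finS[OF B(1)]
      by (subst card_Un_disjoint) (auto simp: D_def card_image)
    also have "\<dots> \<le> card (S (insert y B))"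
      using y B by (intro card_mono[OF finS sub]) auto
    finally have "min (Suc t * r) v \<le> card (S (insert y B))" using D B(3) False by auto
    moreover have "card (insert y B) \<le> Suc t" using B(2) finB by (simp add: card_insert_if)
    ultimately show ?thesis using y B(1) unfolding S_def
      by (intro exI[of _ "insert y B"]) auto
  qed
qed

text \<open>
  Translating a bounded number of elements greedily covers nearly as many sums as the number \<open>n\<close> of
  available translates. The factor two, up to a small loss, comes from
  doing this at both ends: every sum of one of the lowest elements \<open>L\<close> with an element outside the
  highest elements \<open>H\<close> is smaller than every sum of an element of \<open>H\<close> with an element outside \<open>L\<close>.
\<close>

lemma sparse_subset_many_sums:
  assumes fin: "finite X" and n: "card X = n" "100000 \<le> n" and q: "n \<le> 10 * q" "q \<le> n"
  shows "\<exists>Y \<subseteq> X. card Y = q \<and> 19 * n \<le> 10 * card (distinct_sums Y)"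
proof -
  obtain L where L: "L \<subseteq> X" "card L = 1600" "\<forall>l\<in>L. \<forall>z\<in>X - L. l < z"
    using initial_segment_exists[OF fin, of 1600] n by auto
  obtain K where K: "K \<subseteq> X" "card K = n - 1600" "\<forall>l\<in>K. \<forall>z\<in>X - K. l < z"
    using initial_segment_exists[OF fin, of "n - 1600"] n by auto
  define H where "H = X - K"
  have finite: "finite L" "finite K" "finite H" "finite (X - L)"
    using L K fin finite_subset by (auto simp: H_def)
  have cH: "card H = 1600" using K n finite by (simp add: H_def card_Diff_subset)
  have cXL: "card (X - L) = n - 1600" using L n finite by (simp add: card_Diff_subset)
  \<comment> \<open>with \<open>1600\<close> elements to translate, covering \<open>39 / 40\<close> of the target gains \<open>1600 / 40 - 1 = 39\<close>
    sums per translate, hence needs only about \<open>n / 40\<close> translates\<close>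
  define v where "v = 39 * (n - 1600) div 40"
  define t where "t = v div 39 + 1"
  have v: "40 * v \<le> 39 * (n - 1600)" "39 * (n - 1600) < 40 * v + 40" unfolding v_def by linarith+
  have t: "v \<le> t * 39" "39 * t \<le> v + 39" 
    using dividend_less_div_times[of 39 v] div_times_less_eq_dividend[of v 39] by (simp_all add: t_def algebra_simps)
  have "card K \<noteq> 0" "card (X - L) \<noteq> 0" using K(2) cXL n by auto
  then have ne: "K \<noteq> {}" "X - L \<noteq> {}" by (metis card.empty)+
  obtain B1 where B1: "B1 \<subseteq> K" "card B1 \<le> t"
    "v \<le> card {b + c | b c. b \<in> B1 \<and> c \<in> L \<and> b \<noteq> c}"
    using greedy_translates[OF finite(1,2) ne(1), of 39 v t] K(2) L(2) v t by auto
  obtain B2 where B2: "B2 \<subseteq> X - L" "card B2 \<le> t"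
    "v \<le> card {b + c | b c. b \<in> B2 \<and> c \<in> H \<and> b \<noteq> c}"
    using greedy_translates[OF finite(3,4) ne(2), of 39 v t] cXL cH v t by auto
  define S1 where "S1 = {b + c | b c. b \<in> B1 \<and> c \<in> L \<and> b \<noteq> c}"
  define S2 where "S2 = {b + c | b c. b \<in> B2 \<and> c \<in> H \<and> b \<noteq> c}"
  have finB: "finite B1" "finite B2" using B1 B2 finite finite_subset by blast+
  define Y0 where "Y0 = L \<union> B1 \<union> (H \<union> B2)"
  have Y0X: "Y0 \<subseteq> X" using L K B1 B2 by (auto simp: Y0_def H_def)
  have finY0: "finite Y0" using Y0X fin finite_subset by blast
  have "card Y0 \<le> (card L + card B1) + (card H + card B2)"
    unfolding Y0_def by (intro order_trans[OF card_Un_le] add_mono card_Un_le)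
  also have "\<dots> \<le> q" using L(2) cH B1(2) B2(2) v t n q by linarith
  finally obtain Y where Y: "Y0 \<subseteq> Y" "Y \<subseteq> X" "card Y = q"
    using exists_subset_between[OF _ _ Y0X fin, of q] q n by auto
  have disj: "S1 \<inter> S2 = {}"
  proof -
    have "b + c < b' + c'" if "b \<in> B1" "c \<in> L" "b' \<in> B2" "c' \<in> H" for b c b' c'
    proof -
      have "b < c'" using that B1(1) K(3) by (auto simp: H_def)
      moreover have "c < b'" using that B2(1) L(3) by auto
      ultimately show ?thesis by simp
    qed
    then show ?thesis unfolding S1_def S2_def by (fastforce dest: less_imp_neq)
  qed
  have finY: "finite (distinct_sums Y)"
    using Y fin finite_subset finite_distinct_sums by blast
  have sub: "S1 \<subseteq> distinct_sums Y" "S2 \<subseteq> distinct_sums Y"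
    using Y(1) by (auto simp: S1_def S2_def Y0_def intro!: distinct_sumsI)
  have "2 * v \<le> card S1 + card S2" using B1(3) B2(3) by (simp add: S1_def S2_def)
  also have "\<dots> = card (S1 \<union> S2)"
    using disj sub finY finite_subset by (metis card_Un_disjoint)
  also have "\<dots> \<le> card (distinct_sums Y)" using sub finY by (intro card_mono) auto
  finally show ?thesis using Y v n by (intro exI[of _ Y]) auto
qed

section \<open>Fresh sums and the choice of a pivot\<close>

definition fresh_sums :: "nat set \<Rightarrow> nat \<Rightarrow> nat set" where
  "fresh_sums Y z = (+) z ` (Y \<inter> {..<z}) - distinct_sums (Y \<inter> {..<z})"

text \<open>
  A sum that is fresh at \<open>z\<close> has both summands at most \<open>z\<close>, so it is a sum of elements below any later
  \<open>z'\<close> and cannot be fresh again.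
\<close>

lemma sum_card_fresh_sums_le:
  assumes "finite Y" "Z \<subseteq> Y"
  shows "(\<Sum>z\<in>Z. card (fresh_sums Y z)) \<le> card (distinct_sums Y)"
proof -
  have fin: "finite Z" using assms finite_subset by blast
  have disj: "fresh_sums Y z \<inter> fresh_sums Y z' = {}" if "z < z'" "z \<in> Y" for z z'
  proof -
    have "fresh_sums Y z \<subseteq> distinct_sums (Y \<inter> {..<z'})"
      using that by (auto simp: fresh_sums_def intro!: distinct_sumsI)
    then show ?thesis by (auto simp: fresh_sums_def)
  qed
  have "(\<Sum>z\<in>Z. card (fresh_sums Y z)) = card (\<Union>z\<in>Z. fresh_sums Y z)"
  proof (rule card_UN_disjoint[symmetric, OF fin])
    show "\<forall>z\<in>Z. finite (fresh_sums Y z)" using assms(1) by (auto simp: fresh_sums_def)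
    show "\<forall>i\<in>Z. \<forall>j\<in>Z. i \<noteq> j \<longrightarrow> fresh_sums Y i \<inter> fresh_sums Y j = {}"
      using disj assms(2) by (metis Int_commute nat_neq_iff subsetD)
  qed
  also have "\<dots> \<le> card (distinct_sums Y)"
    using assms by (intro card_mono finite_distinct_sums)
      (auto simp: fresh_sums_def intro!: distinct_sumsI)
  finally show ?thesis .
qed

text \<open>
  Averaging over the upper half of \<open>Y\<close>. The pivot must not be too low, since the elements below it
  serve as the test set for everything above it.
\<close>

lemma exists_pivot:
  assumes "finite Y" "Y \<noteq> {}"
  shows "\<exists>x\<in>Y. card Y \<le> 2 * card (Y \<inter> {..x}) \<and>
    card Y * card (fresh_sums Y x) \<le> 2 * card (distinct_sums Y)"
proof -
  obtain L where L: "L \<subseteq> Y" "card L = card Y div 2" "\<forall>l\<in>L. \<forall>z\<in>Y - L. l < z"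
    using initial_segment_exists[OF assms(1), of "card Y div 2"] by auto
  have finL: "finite L" using L assms finite_subset by blast
  have c: "card (Y - L) = card Y - card Y div 2" using L finL by (simp add: card_Diff_subset)
  have pos: "card Y > 0" using assms by (simp add: card_gt_0_iff)
  have ne: "Y - L \<noteq> {}" using c pos by force
  define x where "x = arg_min_on (\<lambda>z. card (fresh_sums Y z)) (Y - L)"
  have x: "x \<in> Y - L" "\<And>z. z \<in> Y - L \<Longrightarrow> card (fresh_sums Y x) \<le> card (fresh_sums Y z)"
    using arg_min_if_finite(1)[OF finite_Diff[OF assms(1)] ne] arg_min_least[OF finite_Diff[OF assms(1)] ne]
    by (simp_all only: x_def)
  have "card (Y - L) * card (fresh_sums Y x) \<le> (\<Sum>z\<in>Y - L. card (fresh_sums Y z))"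
    using x(2) sum_bounded_below[of "Y - L" "card (fresh_sums Y x)" "\<lambda>z. card (fresh_sums Y z)"]
    by simp
  also have "\<dots> \<le> card (distinct_sums Y)" by (rule sum_card_fresh_sums_le[OF assms(1)]) auto
  finally have "card (Y - L) * card (fresh_sums Y x) \<le> card (distinct_sums Y)" .
  moreover have "card Y \<le> 2 * card (Y - L)" using c by linarith
  ultimately have 1: "card Y * card (fresh_sums Y x) \<le> 2 * card (distinct_sums Y)"
    using mult_le_mono1[of "card Y" "2 * card (Y - L)" "card (fresh_sums Y x)"] by linarith
  have "l \<le> x" if "l \<in> L" for l using L(3) x(1) that by (meson less_imp_le)
  then have "insert x L \<subseteq> Y \<inter> {..x}" using L(1) x(1) by auto
  then have "card (insert x L) \<le> card (Y \<inter> {..x})" using assms(1) by (intro card_mono) auto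
  then have "card Y \<le> 2 * card (Y \<inter> {..x})" using x(1) finL L(2) by simp
  with 1 x(1) show ?thesis by blast
qed

section \<open>Encoding a set by its surprises\<close>

text \<open>
  Positions are visited in the order given by \<open>visit\<close>, and whether a position is predicted depends only
  on the part of the set visited before. A decoder that has reconstructed this part knows whether the
  next position is predicted and how many predicted positions preceded it. So it suffices to store the
  members that were not predicted and, for those that were, their rank among the predicted positions.
  Storing ranks instead of positions is what makes predicted members cheap.
\<close>

lemma online_code_inj:
  fixes visit :: "'a \<Rightarrow> nat" and pred :: "'a set \<Rightarrow> 'a set"
  assumes inj: "inj visit"
    and fin: "finite (pred Y)" "finite (pred Y')"
    and local: "\<And>A B w. (\<And>v. visit v < visit w \<Longrightarrow> v \<in> A \<longleftrightarrow> v \<in> B) \<Longrightarrow> w \<in> pred A \<longleftrightarrow> w \<in> pred B"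
    and surprises: "Y - pred Y = Y' - pred Y'"
    and ranks: "(\<lambda>w. card {v\<in>pred Y. visit v < visit w}) ` (Y \<inter> pred Y)
      = (\<lambda>w. card {v\<in>pred Y'. visit v < visit w}) ` (Y' \<inter> pred Y')"
  shows "Y = Y'"
proof -
  define rank where "rank = (\<lambda>A w. card {v\<in>pred A. visit v < visit w})"
  have rank_inj: "w = w'" if "w \<in> pred A" "w' \<in> pred A" "rank A w = rank A w'" "finite (pred A)"
    for A w w'
  proof -
    have less: "rank A w < rank A w'" if "w \<in> pred A" "visit w < visit w'" for w w'
      unfolding rank_def using that \<open>finite (pred A)\<close> by (intro psubset_card_mono) auto
    show ?thesis using less that inj by (metis injD nat_neq_iff)
  qed
  \<comment> \<open>the decoder at position \<open>w\<close>, in one direction; both directions give the induction step\<close>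
  have step: "w \<in> B"
    if agree: "\<And>v. visit v < visit w \<Longrightarrow> v \<in> A \<longleftrightarrow> v \<in> B" and w: "w \<in> A"
      and "finite (pred A)" "finite (pred B)"
      and sur: "A - pred A = B - pred B" and rk: "rank A ` (A \<inter> pred A) = rank B ` (B \<inter> pred B)" for A B w
  proof (cases "w \<in> pred A")
    case False
    then show ?thesis using w sur by auto
  next
    case True
    have wB: "w \<in> pred B" using True local[OF agree] by auto
    have "v \<in> pred A \<longleftrightarrow> v \<in> pred B" if "visit v < visit w" for v
      using that by (intro local agree) auto
    then have "rank A w = rank B w" unfolding rank_def by (metis (mono_tags, lifting))
    then have "rank B w \<in> rank B ` (B \<inter> pred B)" using w True rk by (metis IntI image_eqI)
    then obtain w' where "w' \<in> B \<inter> pred B" "rank B w = rank B w'" by auto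
    then show ?thesis using rank_inj wB \<open>finite (pred B)\<close> by blast
  qed
  have rk: "rank Y ` (Y \<inter> pred Y) = rank Y' ` (Y' \<inter> pred Y')" using ranks by (simp add: rank_def)
  have "w \<in> Y \<longleftrightarrow> w \<in> Y'" for w
  proof (induction "visit w" arbitrary: w rule: less_induct)
    case less
    then have agree: "\<And>v. visit v < visit w \<Longrightarrow> v \<in> Y \<longleftrightarrow> v \<in> Y'" by blast
    show ?case using step[of w Y Y'] step[of w Y' Y] agree fin surprises rk by metis
  qed
  then show ?thesis by blast
qed

text \<open>
  Down from \<open>x\<close> to \<open>0\<close>, then up from \<open>x + 1\<close>: the values \<open>0, \<dots>, x\<close> are used by the way down, so the
  positions above \<open>x\<close> can serve as their own times.
\<close>

definition visit_time :: "nat \<Rightarrow> nat \<Rightarrow> nat" where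
  "visit_time x w = (if w \<le> x then x - w else w)"

lemma inj_visit_time: "inj (visit_time x)"
  unfolding visit_time_def inj_def by auto

text \<open>
  The two parts use only elements visited before \<open>w\<close>: those between \<open>w\<close> and \<open>x\<close> on the way down, all
  those below \<open>w\<close> on the way up. The fraction of one quarter balances two costs. A
  larger fraction predicts fewer positions, while a smaller one gives the unpredicted members more
  fresh sums and so makes them rarer. The pivot itself is never predicted.
\<close>

definition predicted :: "nat \<Rightarrow> nat set \<Rightarrow> nat set" where
  "predicted x Y =
     {w. w < x \<and> w + x \<in> distinct_sums (Y \<inter> {w<..<x})} \<union>
     {w. x < w \<and> card (Y \<inter> {..x}) < 4 * card {y \<in> Y \<inter> {..x}. w + y \<in> distinct_sums (Y \<inter> {..<w})}}"

lemma predicted_local: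
  assumes "\<And>v. visit_time x v < visit_time x w \<Longrightarrow> v \<in> A \<longleftrightarrow> v \<in> B"
  shows "w \<in> predicted x A \<longleftrightarrow> w \<in> predicted x B"
proof (cases w x rule: linorder_cases)
  case less
  have "A \<inter> {w<..<x} = B \<inter> {w<..<x}" using assms less by (auto simp: visit_time_def)
  then show ?thesis using less by (auto simp: predicted_def)
next
  case equal
  then show ?thesis by (auto simp: predicted_def)
next
  case greater
  have "visit_time x v < visit_time x w" if "v < w" for v
    using that greater by (auto simp: visit_time_def)
  then have agree: "v \<in> A \<longleftrightarrow> v \<in> B" if "v < w" for v using assms that by blast
  then have 1: "A \<inter> {..<w} = B \<inter> {..<w}" by blast
  have "v \<in> A \<longleftrightarrow> v \<in> B" if "v \<le> x" for v using agree that greater by (meson le_less_trans)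
  then have 2: "A \<inter> {..x} = B \<inter> {..x}" by blast
  have "\<not> w < x" using greater by simp
  then show ?thesis unfolding predicted_def Un_iff mem_Collect_eq 1 2 by blast
qed

text \<open>
  On the way down, \<open>w + x\<close> is a sum, which leaves at most \<open>M = card (distinct_sums Y)\<close> positions. On the
  way up, double counting applies: a pair of a test element \<open>y \<le> x\<close> and a sum determines \<open>w\<close>, and
  each predicted \<open>w\<close> accounts for more than a quarter of the test elements, which leaves \<open>4 M\<close>.
\<close>

lemma card_predicted_le:
  assumes fin: "finite Y" and x: "x \<in> Y"
  shows "finite (predicted x Y)" "card (predicted x Y) \<le> 5 * card (distinct_sums Y)"
proof -
  define T where "T = distinct_sums Y"
  have finT: "finite T" using fin by (simp add: T_def finite_distinct_sums)
  define J where "J = Y \<inter> {..x}"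
  have J: "finite J" "0 < card J" using fin x by (auto simp: J_def card_gt_0_iff)
  define D where "D = {w. w < x \<and> w + x \<in> distinct_sums (Y \<inter> {w<..<x})}"
  define U where "U = {w. x < w \<and> card J < 4 * card {y \<in> J. w + y \<in> distinct_sums (Y \<inter> {..<w})}}"
  have eq: "predicted x Y = D \<union> U" by (simp add: predicted_def D_def U_def J_def)
  have mono: "distinct_sums (Y \<inter> S) \<subseteq> T" for S by (simp add: T_def distinct_sums_mono)
  have D: "finite D" "card D \<le> card T"
  proof -
    show "finite D" by (rule finite_subset[of _ "{..x}"]) (auto simp: D_def)
    show "card D \<le> card T"
      by (rule card_inj_on_le[where f="\<lambda>w. w + x"]) (use finT mono in \<open>auto simp: D_def inj_on_def\<close>)
  qed
  define W where "W = (\<lambda>w. {y \<in> J. w + y \<in> T})"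
  have W: "card J < 4 * card (W w)" if "w \<in> U" for w
  proof -
    have "card {y \<in> J. w + y \<in> distinct_sums (Y \<inter> {..<w})} \<le> card (W w)"
      unfolding W_def using J mono by (intro card_mono) auto
    then show ?thesis using that by (auto simp: U_def)
  qed
  have finU: "finite U"
  proof (rule finite_subset)
    show "U \<subseteq> {..Max T}"
    proof
      fix w assume "w \<in> U"
      then have "W w \<noteq> {}" using W by fastforce
      then obtain y where "w + y \<in> T" by (auto simp: W_def)
      then have "w + y \<le> Max T" using finT by simp
      then show "w \<in> {..Max T}" by simp
    qed
  qed simp
  have "card U * card J = (\<Sum>w\<in>U. card J)" by simp
  also have "\<dots> \<le> (\<Sum>w\<in>U. 4 * card (W w))" using W by (intro sum_mono) force
  also have "\<dots> = 4 * card (Sigma U W)"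
    using finU J by (subst card_SigmaI) (auto simp: W_def sum_distrib_left)
  also have "card (Sigma U W) \<le> card (J \<times> T)"
    by (rule card_inj_on_le[where f="\<lambda>(w, y). (y, w + y)"])
      (use J finT in \<open>auto simp: inj_on_def W_def\<close>)
  finally have "card U * card J \<le> (4 * card T) * card J" by (simp add: card_cartesian_product algebra_simps)
  then have U: "card U \<le> 4 * card T" using J by simp
  show "finite (predicted x Y)" using eq D finU by simp
  have "card (predicted x Y) \<le> card D + card U" unfolding eq by (rule card_Un_le)
  then show "card (predicted x Y) \<le> 5 * card (distinct_sums Y)" using D U by (simp add: T_def)
qed

text \<open>
  Unpredicted members below \<open>x\<close> correspond to sums fresh at \<open>x\<close>, and there are at most \<open>2 M / q\<close> of
  these by the choice of the pivot. An unpredicted member above \<open>x\<close> has fresh sums with three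
  quarters of the at least \<open>q / 2\<close> members up to \<open>x\<close>, and there are only \<open>M\<close> fresh sums in total. The
  bounds \<open>2 M / q\<close> and \<open>8 M / (3 q)\<close> add up to \<open>14 M / (3 q)\<close>; subtracting one leaves out the pivot.
\<close>

lemma card_unpredicted_le:
  assumes fin: "finite Y" and x: "x \<in> Y"
    and half: "card Y \<le> 2 * card (Y \<inter> {..x})"
    and few: "card Y * card (fresh_sums Y x) \<le> 2 * card (distinct_sums Y)"
  shows "x \<in> Y - predicted x Y"
    "3 * card Y * (card (Y - predicted x Y) - 1) \<le> 14 * card (distinct_sums Y)"
proof -
  show xin: "x \<in> Y - predicted x Y" using x by (auto simp: predicted_def)
  define M where "M = card (distinct_sums Y)"
  define J where "J = Y \<inter> {..x}"
  have J: "finite J" using fin by (auto simp: J_def)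
  define D where "D = {w \<in> Y - predicted x Y. w < x}"
  define U where "U = {w \<in> Y - predicted x Y. x < w}"
  have finDU: "finite D" "finite U" using fin by (auto simp: D_def U_def)
  have "Y - predicted x Y - {x} = D \<union> U" by (auto simp: D_def U_def)
  then have "card (Y - predicted x Y) - 1 = card (D \<union> U)"
    using xin by (metis card_Diff_singleton)
  then have c: "card (Y - predicted x Y) - 1 \<le> card D + card U" using card_Un_le by metis
  have "card D \<le> card (fresh_sums Y x)"
  proof (rule card_inj_on_le[where f="(+) x"])
    show "(+) x ` D \<subseteq> fresh_sums Y x"
    proof
      fix s assume "s \<in> (+) x ` D"
      then obtain w where w: "s = x + w" "w \<in> Y" "w < x" "w \<notin> predicted x Y" by (auto simp: D_def)
      have "s \<notin> distinct_sums (Y \<inter> {..<x})"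
      proof
        assume "s \<in> distinct_sums (Y \<inter> {..<x})"
        then obtain a b where ab: "s = a + b" "a \<in> Y" "b \<in> Y" "a < x" "b < x" "a \<noteq> b"
          by (auto simp: distinct_sums_def)
        \<comment> \<open>both summands are below \<open>x\<close>, hence both are above \<open>w\<close>\<close>
        then have "w < a" "w < b" using w(1) by linarith+
        then have "a + b \<in> distinct_sums (Y \<inter> {w<..<x})" using ab by (intro distinct_sumsI) auto
        then show False using w ab(1) by (auto simp: predicted_def add.commute)
      qed
      then show "s \<in> fresh_sums Y x" using w by (auto simp: fresh_sums_def)
    qed
  qed (use fin in \<open>auto simp: fresh_sums_def\<close>)
  then have D: "card Y * card D \<le> 2 * M" using few M_def by (meson mult_le_mono2 order_trans)
  have fresh: "3 * card J \<le> 4 * card (fresh_sums Y z)" if "z \<in> U" for z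
  proof -
    define V where "V = {y\<in>J. z + y \<in> distinct_sums (Y \<inter> {..<z})}"
    have z: "x < z" "4 * card V \<le> card J" using that by (auto simp: U_def predicted_def J_def V_def)
    have "card (J - V) \<le> card (fresh_sums Y z)"
      by (rule card_inj_on_le[where f="(+) z"])
        (use fin z in \<open>auto simp: fresh_sums_def V_def J_def\<close>)
    moreover have "card (J - V) = card J - card V"
      using J by (intro card_Diff_subset) (auto simp: V_def)
    ultimately show ?thesis using z by linarith
  qed
  have "card U * (3 * card J) = (\<Sum>z\<in>U. 3 * card J)" by simp
  also have "\<dots> \<le> (\<Sum>z\<in>U. 4 * card (fresh_sums Y z))" by (intro sum_mono fresh)
  also have "\<dots> = 4 * (\<Sum>z\<in>U. card (fresh_sums Y z))" by (simp add: sum_distrib_left)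
  also have "\<dots> \<le> 4 * M"
    unfolding M_def by (intro mult_le_mono2 sum_card_fresh_sums_le fin) (auto simp: U_def)
  finally have "card U * (3 * card J) \<le> 4 * M" .
  moreover have "card U * (3 * card Y) \<le> card U * (3 * (2 * card J))"
    using half by (intro mult_le_mono2) (simp add: J_def)
  ultimately have "3 * card Y * card U \<le> 8 * M" by (simp only: ac_simps)
  then have "3 * card Y * (card D + card U) \<le> 14 * M" using D by (simp add: algebra_simps)
  then show "3 * card Y * (card (Y - predicted x Y) - 1) \<le> 14 * card (distinct_sums Y)"
    using c M_def by (meson mult_le_mono2 order_trans)
qed

text \<open>
  The exponential moment bound: a subset of size at most \<open>q\<close> has weight \<open>y ^ card B \<ge> y ^ q\<close>, and the weights of
  all subsets sum to \<open>(1 + y) ^ card A\<close>.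
\<close>

lemma card_small_subsets_le:
  fixes y :: real
  assumes "finite A" "0 < y" "y \<le> 1"
  shows "real (card {B. B \<subseteq> A \<and> card B \<le> q}) \<le> (1 + y) ^ card A / y ^ q"
proof -
  have "y ^ q * real (card {B. B \<subseteq> A \<and> card B \<le> q}) = (\<Sum>B | B \<subseteq> A \<and> card B \<le> q. y ^ q)"
    by simp
  also have "\<dots> \<le> (\<Sum>B | B \<subseteq> A \<and> card B \<le> q. y ^ card B)"
    using assms by (intro sum_mono power_decreasing) auto
  also have "\<dots> \<le> (\<Sum>B\<in>Pow A. y ^ card B)"
    using assms by (intro sum_mono2) auto
  also have "\<dots> = (\<Prod>a\<in>A. 1 + y)" using assms(1) using prod_add[of A "\<lambda>_. y" "\<lambda>_. 1"] by (simp add: add.commute)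
  finally show ?thesis using assms by (simp add: field_simps)
qed

text \<open>
  Such a pair is read off from a list of length \<open>Suc a\<close> with head \<open>x\<close> and set of entries \<open>G\<close>, so marking
  a point of \<open>G\<close> costs nothing extra.
\<close>

lemma card_pointed_subsets_le:
  "finite {(x, G). x \<in> G \<and> G \<subseteq> {..<N::nat} \<and> card G \<le> Suc a}"
  "card {(x, G). x \<in> G \<and> G \<subseteq> {..<N::nat} \<and> card G \<le> Suc a} \<le> N ^ Suc a"
proof -
  let ?L = "{xs. set xs \<subseteq> {..<N} \<and> length xs = Suc a}"
  have fin: "finite ?L" by (rule finite_lists_length_eq) simp
  have sub: "{(x, G). x \<in> G \<and> G \<subseteq> {..<N} \<and> card G \<le> Suc a} \<subseteq> (\<lambda>xs. (hd xs, set xs)) ` ?L"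
  proof clarify
    fix x G assume xG: "x \<in> G" "G \<subseteq> {..<N}" "card G \<le> Suc a"
    have "finite G" using xG finite_subset by blast
    then obtain ys where ys: "set ys = G" "length ys = card G"
      using finite_distinct_list distinct_card by metis
    define xs where "xs = x # remove1 x ys @ replicate (Suc a - card G) x"
    have "set xs = G"
      using ys xG by (auto simp: xs_def dest: set_remove1_subset[THEN subsetD] in_set_remove1[THEN iffD2])
    moreover have "length xs = Suc a"
      using ys xG length_pos_if_in_set[of x ys] by (simp add: xs_def length_remove1)
    ultimately show "(x, G) \<in> (\<lambda>xs. (hd xs, set xs)) ` ?L"
      using xG by (intro image_eqI[of _ _ xs]) (auto simp: xs_def)
  qed
  show "finite {(x, G). x \<in> G \<and> G \<subseteq> {..<N} \<and> card G \<le> Suc a}"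
    using finite_subset[OF sub finite_imageI[OF fin]] .
  have "card {(x, G). x \<in> G \<and> G \<subseteq> {..<N} \<and> card G \<le> Suc a} \<le> card ((\<lambda>xs. (hd xs, set xs)) ` ?L)"
    by (intro card_mono finite_imageI fin sub)
  also have "\<dots> \<le> card ?L" by (intro card_image_le fin)
  also have "\<dots> = N ^ Suc a" by (simp add: card_lists_length_eq)
  finally show "card {(x, G). x \<in> G \<and> G \<subseteq> {..<N} \<and> card G \<le> Suc a} \<le> N ^ Suc a" .
qed

text \<open>
  The factor \<open>64 ^ q * (65 / 64) ^ (5 * M)\<close> bounds the number of sets of at most \<open>q\<close> ranks below \<open>5 * M\<close>.
  The weight \<open>1 / 64\<close> is close to the best choice \<open>q / (5 * M)\<close> when \<open>M\<close> is about \<open>15 * q\<close>, the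
  range that matters below.
\<close>

theorem card_sets_few_distinct_sums:
  fixes N q M :: nat
  defines "F \<equiv> {Y. Y \<subseteq> {..<N} \<and> card Y = q \<and> card (distinct_sums Y) = M}"
  assumes q: "0 < q"
  shows "real (card F) \<le> real N ^ Suc (14 * M div (3 * q)) * (64 ^ q * (65 / 64) ^ (5 * M))"
proof -
  define a where "a = 14 * M div (3 * q)"
  define rank where "rank = (\<lambda>x Y w. card {v\<in>predicted x Y. visit_time x v < visit_time x w})"
  define code where "code = (\<lambda>x Y. ((x, Y - predicted x Y), rank x Y ` (Y \<inter> predicted x Y)))"
  define P where "P = {(x, G). x \<in> G \<and> G \<subseteq> {..<N} \<and> card G \<le> Suc a}"
  define Q where "Q = {B. B \<subseteq> {..<5 * M} \<and> card B \<le> q}"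
  have "\<exists>x. x \<in> Y \<and> code x Y \<in> P \<times> Q" if "Y \<in> F" for Y
  proof -
    from that have Y: "Y \<subseteq> {..<N}" "card Y = q" "card (distinct_sums Y) = M" by (auto simp: F_def)
    have fin: "finite Y" using Y finite_subset by blast
    have "Y \<noteq> {}" using Y q by auto
    then obtain x where x: "x \<in> Y" "card Y \<le> 2 * card (Y \<inter> {..x})"
      "card Y * card (fresh_sums Y x) \<le> 2 * card (distinct_sums Y)"
      using exists_pivot[OF fin] by blast
    note un = card_unpredicted_le[OF fin x]
    have "card (Y - predicted x Y) - 1 \<le> a"
      using un(2) Y q by (simp add: a_def less_eq_div_iff_mult_less_eq mult.commute)
    then have "(x, Y - predicted x Y) \<in> P" using un(1) Y by (auto simp: P_def)
    moreover have "rank x Y ` (Y \<inter> predicted x Y) \<in> Q"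
    proof -
      note pr = card_predicted_le[OF fin x(1)]
      have "rank x Y w < 5 * M" if "w \<in> predicted x Y" for w
      proof -
        have "rank x Y w < card (predicted x Y)"
          unfolding rank_def using that pr(1) by (intro psubset_card_mono) auto
        then show ?thesis using pr(2) Y by simp
      qed
      moreover have "card (rank x Y ` (Y \<inter> predicted x Y)) \<le> card Y"
        using fin by (meson card_image_le card_mono finite_Int inf_le1 order_trans)
      ultimately show ?thesis using Y by (auto simp: Q_def)
    qed
    ultimately show ?thesis using x by (auto simp: code_def)
  qed
  then obtain piv where piv: "\<And>Y. Y \<in> F \<Longrightarrow> piv Y \<in> Y \<and> code (piv Y) Y \<in> P \<times> Q" by metis
  have inj: "inj_on (\<lambda>Y. code (piv Y) Y) F"
  proof (rule inj_onI)
    fix Y Y' assume F: "Y \<in> F" "Y' \<in> F" and eq: "code (piv Y) Y = code (piv Y') Y'"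
    define x where "x = piv Y"
    have x: "piv Y' = x" "x \<in> Y" "x \<in> Y'" using eq piv[OF F(1)] piv[OF F(2)] by (auto simp: code_def x_def)
    have fin: "finite Y" "finite Y'" using F finite_subset by (auto simp: F_def)
    show "Y = Y'"
    proof (rule online_code_inj[of "visit_time x" "predicted x"])
      show "finite (predicted x Y)" "finite (predicted x Y')"
        using card_predicted_le(1) fin x by auto
      show "w \<in> predicted x A \<longleftrightarrow> w \<in> predicted x B"
        if "\<And>v. visit_time x v < visit_time x w \<Longrightarrow> v \<in> A \<longleftrightarrow> v \<in> B" for A B w
        using that by (rule predicted_local)
    qed (use eq x in \<open>simp_all add: code_def rank_def x_def inj_visit_time\<close>)
  qed
  have finP: "finite P" and cP: "card P \<le> N ^ Suc a"
    unfolding P_def by (rule card_pointed_subsets_le)+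
  have finQ: "finite Q" unfolding Q_def by simp
  have cQ: "real (card Q) \<le> 64 ^ q * (65 / 64) ^ (5 * M)"
    using card_small_subsets_le[of "{..<5 * M}" "1 / 64" q]
    by (simp add: Q_def power_divide field_simps)
  have "card F \<le> card (P \<times> Q)"
    by (rule card_inj_on_le[OF inj]) (use piv finP finQ in blast)+
  then have "real (card F) \<le> real (card P) * real (card Q)"
    by (metis card_cartesian_product of_nat_le_iff of_nat_mult)
  also have "\<dots> \<le> real N ^ Suc a * (64 ^ q * (65 / 64) ^ (5 * M))"
    using cP cQ by (intro mult_mono) (simp_all only: of_nat_le_iff of_nat_0_le_iff zero_le_power flip: of_nat_power)
  finally show ?thesis by (simp add: a_def)
qed

section \<open>Random subsets and cliques\<close>

lemma prob_random_subset_contains: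
  assumes "finite C" "S \<subseteq> C"
  shows "measure_pmf.prob (pmf_of_set (Pow C)) {A. S \<subseteq> A} = 1 / 2 ^ card S"
proof -
  have finS: "finite S" using assms finite_subset by blast
  have "bij_betw (\<lambda>A. A \<union> S) (Pow (C - S)) (Pow C \<inter> {A. S \<subseteq> A})"
    by (rule bij_betw_byWitness[where f'="\<lambda>A. A - S"]) (use assms in auto)
  then have "card (Pow C \<inter> {A. S \<subseteq> A}) = 2 ^ card (C - S)"
    using assms(1) by (simp add: bij_betw_same_card[symmetric] card_Pow)
  moreover have "card C = card (C - S) + card S"
    using assms finS card_mono[OF assms] by (simp add: card_Diff_subset)
  ultimately show ?thesis
    using assms(1) by (subst measure_pmf_of_set) (auto simp: card_Pow power_add)
qed

definition sums_mod :: "nat \<Rightarrow> nat set \<Rightarrow> int set" where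
  "sums_mod N Y = (\<lambda>s. int (s mod N)) ` distinct_sums Y"

text \<open>
  Sums of two distinct elements of the lower half stay below \<open>N\<close>, and those of the upper half lie
  between \<open>N\<close> and \<open>2 * N\<close>.
\<close>

lemma inj_on_mod_half:
  assumes "Y \<subseteq> {..<N}" and half: "Y \<subseteq> {..<(N + 1) div 2} \<or> Y \<inter> {..<(N + 1) div 2} = {}"
  shows "inj_on (\<lambda>s. s mod N) (distinct_sums Y)"
  using half
proof
  assume low: "Y \<subseteq> {..<(N + 1) div 2}"
  have "s < N" if "s \<in> distinct_sums Y" for s
  proof -
    from that obtain a b where ab: "s = a + b" "a \<in> Y" "b \<in> Y" by (auto simp: distinct_sums_def)
    have "a < (N + 1) div 2" "b < (N + 1) div 2" using ab low by auto
    then show ?thesis using ab(1) by linarith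
  qed
  then show ?thesis by (auto simp: inj_on_def)
next
  assume disj: "Y \<inter> {..<(N + 1) div 2} = {}"
  have "s mod N = s - N \<and> N \<le> s" if "s \<in> distinct_sums Y" for s
  proof -
    from that obtain a b where ab: "s = a + b" "a \<in> Y" "b \<in> Y" by (auto simp: distinct_sums_def)
    have "a < N" "b < N" "(N + 1) div 2 \<le> a" "(N + 1) div 2 \<le> b" using ab assms(1) disj by force+
    then have "N \<le> s" "s - N < N" using ab(1) by linarith+
    then show ?thesis by (metis le_mod_geq mod_less)
  qed
  then show ?thesis by (metis (no_types, lifting) inj_onI le_add_diff_inverse)
qed

lemma clique_contains_sums_mod:
  assumes S: "S \<subseteq> {0..<int N}" "clique S (cayley_sum_edges (integer_mod_group N) A)"
    and Y: "Y \<subseteq> nat ` S"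
  shows "sums_mod N Y \<subseteq> A"
proof -
  have "int ((a + b) mod N) \<in> A" if "a \<in> Y" "b \<in> Y" "a \<noteq> b" for a b
  proof -
    have ab: "int a \<in> S" "int b \<in> S" "int a \<noteq> int b" using that Y S(1) by force+
    then have "{int a, int b} \<in> cayley_sum_edges (integer_mod_group N) A"
      using S(2) by (auto simp: clique_def)
    then show ?thesis
      by (auto simp: cayley_sum_edges_def doubleton_eq_iff zmod_int add.commute)
  qed
  then show ?thesis by (auto simp: sums_mod_def distinct_sums_def)
qed

definition certificates :: "nat \<Rightarrow> nat \<Rightarrow> nat \<Rightarrow> nat set set" where
  "certificates N q m = {Y. Y \<subseteq> {..<N} \<and> card Y = q \<and> m \<le> card (distinct_sums Y) \<and>
     inj_on (\<lambda>s. s mod N) (distinct_sums Y)}"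

text \<open>
  The slack in the hypotheses leaves room for the roundings \<open>n = \<lceil>80 L\<rceil>\<close>, \<open>q = \<lceil>10 L\<rceil>\<close> and
  \<open>m = \<lceil>152 L\<rceil>\<close>: a clique of more than \<open>160 L\<close> elements has at least \<open>2 * n - 1\<close> of them.
\<close>

lemma large_clique_has_certificate:
  assumes N: "0 < N" and n: "100000 \<le> n" "n \<le> 10 * q" "q \<le> n" "10 * m \<le> 19 * n + 9"
    and large: "2 * n \<le> cayley_sum_clique_number (integer_mod_group N) A + 1"
  shows "\<exists>Y \<in> certificates N q m. sums_mod N Y \<subseteq> A"
proof -
  let ?E = "cayley_sum_edges (integer_mod_group N) A"
  let ?K = "{S. S \<subseteq> carrier (integer_mod_group N) \<and> clique S ?E}"
  have carr: "carrier (integer_mod_group N) = {0..<int N}" using N by (simp add: carrier_integer_mod_group)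
  have "finite ?K" by (rule finite_subset[of _ "Pow {0..<int N}"]) (auto simp: carr)
  moreover have "{} \<in> ?K" by auto
  ultimately have "Max (card ` ?K) \<in> card ` ?K" by (intro Max_in) auto
  then obtain S where S: "S \<subseteq> {0..<int N}" "clique S ?E" "2 * n \<le> card S + 1"
    using large by (auto simp: cayley_sum_clique_number_def clique_number_def carr)
  define X where "X = nat ` S"
  have "inj_on nat S" using S(1) by (intro inj_onI) (metis atLeastLessThan_iff eq_nat_nat_iff subsetD)
  then have cX: "card X = card S" by (simp add: X_def card_image)
  have XN: "X \<subseteq> {..<N}" using S(1) by (force simp: X_def)
  then have finX: "finite X" using finite_subset by blast
  define h where "h = (N + 1) div 2"
  have "card X = card (X \<inter> {..<h}) + card (X - {..<h})"
    using finX by (metis card_Int_Diff)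
  then have "n \<le> card (X \<inter> {..<h}) \<or> n \<le> card (X - {..<h})" using S(3) cX by linarith
  then obtain H where H: "H \<subseteq> X" "n \<le> card H" "H \<subseteq> {..<h} \<or> H \<inter> {..<h} = {}"
    by (metis Diff_disjoint Diff_subset Int_commute inf_le1 inf_le2)
  obtain X' where X': "X' \<subseteq> H" "card X' = n" "finite X'"
    using obtain_subset_with_card_n[OF H(2)] by auto
  obtain Y where Y: "Y \<subseteq> X'" "card Y = q" "19 * n \<le> 10 * card (distinct_sums Y)"
    using sparse_subset_many_sums[OF X'(3,2) n(1-3)] by auto
  have sub: "Y \<subseteq> H" "Y \<subseteq> X" "Y \<subseteq> {..<N}" using Y X' H XN by auto
  have "inj_on (\<lambda>s. s mod N) (distinct_sums Y)"
    using sub H(3) by (intro inj_on_mod_half) (auto simp: h_def)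
  then have "Y \<in> certificates N q m" using Y sub n(4) by (auto simp: certificates_def)
  then show ?thesis using clique_contains_sums_mod[OF S(1,2)] sub by (auto simp: X_def)
qed

lemma prob_contains_certificate_le:
  assumes N: "0 < N" and q: "0 < q"
    and term_le: "\<And>M. m \<le> M \<Longrightarrow>
      real N ^ Suc (14 * M div (3 * q)) * (64 ^ q * (65 / 64) ^ (5 * M)) / 2 ^ M \<le> \<epsilon>"
    and "0 \<le> \<epsilon>"
  shows "measure_pmf.prob (random_subset_mod N) {A. \<exists>Y \<in> certificates N q m. sums_mod N Y \<subseteq> A}
    \<le> (real q ^ 2 + 1) * \<epsilon>"
proof -
  let ?C = "certificates N q m"
  let ?T = "\<lambda>Y. card (distinct_sums Y)"
  have finC: "finite ?C"
    by (rule finite_subset[of _ "Pow {..<N}"]) (auto simp: certificates_def)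
  have p: "measure_pmf.prob (random_subset_mod N) {A. sums_mod N Y \<subseteq> A} = 1 / 2 ^ ?T Y"
    if "Y \<in> ?C" for Y
  proof -
    have "inj_on (\<lambda>s. int (s mod N)) (distinct_sums Y)"
      using that by (auto simp: certificates_def inj_on_def)
    then have "card (sums_mod N Y) = ?T Y" by (simp add: sums_mod_def card_image)
    moreover have "sums_mod N Y \<subseteq> {0..<int N}" using N by (auto simp: sums_mod_def)
    ultimately show ?thesis using N prob_random_subset_contains[of "{0..<int N}" "sums_mod N Y"]
      by (simp add: random_subset_mod_def carrier_integer_mod_group)
  qed
  have le: "?T Y \<in> {m..q\<^sup>2}" if "Y \<in> ?C" for Y
    using that card_distinct_sums_le[of Y] finite_subset[of Y "{..<N}"] by (auto simp: certificates_def)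
  have "measure_pmf.prob (random_subset_mod N) {A. \<exists>Y \<in> ?C. sums_mod N Y \<subseteq> A}
      = measure_pmf.prob (random_subset_mod N) (\<Union>Y\<in>?C. {A. sums_mod N Y \<subseteq> A})"
    by (intro arg_cong[of _ _ "measure_pmf.prob (random_subset_mod N)"]) auto
  also have "\<dots> \<le> (\<Sum>Y\<in>?C. measure_pmf.prob (random_subset_mod N) {A. sums_mod N Y \<subseteq> A})"
    using finC by (intro measure_pmf.finite_measure_subadditive_finite) auto
  also have "\<dots> = (\<Sum>Y\<in>?C. 1 / 2 ^ ?T Y)" using p by simp
  also have "\<dots> = (\<Sum>M\<in>{m..q\<^sup>2}. \<Sum>Y | Y \<in> ?C \<and> ?T Y = M. 1 / 2 ^ ?T Y)"
    using finC le by (intro sum.group[symmetric]) auto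
  also have "\<dots> \<le> (\<Sum>M\<in>{m..q\<^sup>2}. \<epsilon>)"
  proof (rule sum_mono)
    fix M assume M: "M \<in> {m..q\<^sup>2}"
    let ?F = "{Y. Y \<subseteq> {..<N} \<and> card Y = q \<and> ?T Y = M}"
    have "finite ?F" by (rule finite_subset[of _ "Pow {..<N}"]) auto
    then have "card {Y \<in> ?C. ?T Y = M} \<le> card ?F"
      by (rule card_mono) (auto simp: certificates_def)
    then have "real (card {Y \<in> ?C. ?T Y = M}) \<le> real N ^ Suc (14 * M div (3 * q)) * (64 ^ q * (65 / 64) ^ (5 * M))"
      using card_sets_few_distinct_sums[OF q, of N M] by linarith
    then have "real (card {Y \<in> ?C. ?T Y = M}) / 2 ^ M \<le> \<epsilon>"
      using term_le[of M] M by (meson atLeastAtMost_iff divide_right_mono order_trans zero_le_numeral zero_le_power)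
    then show "(\<Sum>Y | Y \<in> ?C \<and> ?T Y = M. 1 / 2 ^ ?T Y) \<le> \<epsilon>" by simp
  qed
  also have "\<dots> = real (card {m..q\<^sup>2}) * \<epsilon>" by simp
  also have "\<dots> \<le> (real q ^ 2 + 1) * \<epsilon>"
    using \<open>0 \<le> \<epsilon>\<close> by (intro mult_right_mono) (auto simp: of_nat_diff not_le simp flip: of_nat_power)
  finally show ?thesis .
qed

text \<open>
  In base \<open>2\<close> logarithms the left-hand side is at most \<open>L + 7 M / 15 + 6 q + 5 M / 44 - M\<close>, where
  \<open>(65 / 64) ^ 44 \<le> 2\<close> was used. The coefficient of \<open>M\<close> is \<open>- 277 / 660\<close>, and \<open>152 * 277 / 660 > 63\<close>
  while \<open>L + 6 q \<le> 61 L + 6\<close>, which leaves the margin \<open>6 - 2 L\<close>.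
\<close>

lemma certificate_term_le:
  assumes N: "1 < N" and q: "10 * log 2 (real N) \<le> real q" "real q \<le> 10 * log 2 (real N) + 1"
    and M: "152 * log 2 (real N) \<le> real M"
  shows "real N ^ Suc (14 * M div (3 * q)) * (64 ^ q * (65 / 64) ^ (5 * M)) / 2 ^ M \<le> 64 / real N ^ 2"
proof -
  define L where "L = log 2 (real N)"
  have L: "L > 0" using N by (simp add: L_def)
  have q0: "real q > 0" using q(1) L by (simp add: L_def)
  have NL: "real N ^ k = 2 powr (L * real k)" for k
    using N by (simp add: L_def powr_powr[symmetric] powr_realpow)
  have "real (14 * M div (3 * q)) \<le> 14 * real M / (3 * real q)"
    using of_nat_div_le_of_nat[of "14 * M" "3 * q", where 'a=real] by simp
  then have "L * real (Suc (14 * M div (3 * q))) \<le> L * (1 + 14 * real M / (3 * real q))"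
    using L by (intro mult_left_mono) auto
  also have "\<dots> \<le> L + 7 / 15 * real M"
  proof -
    have "real M * (10 * L) \<le> real M * real q" using q(1) by (intro mult_left_mono) (auto simp: L_def)
    then show ?thesis using q0 by (simp add: field_simps)
  qed
  finally have e1: "L * real (Suc (14 * M div (3 * q))) \<le> L + 7 / 15 * real M" .
  have e2: "(64::real) ^ q = 2 powr (6 * real q)"
    by (simp add: powr_realpow[symmetric] powr_powr[symmetric])
  have "(65 / 64 :: real) ^ 44 \<le> 2" by (simp add: power_divide)
  then have "(65 / 64 :: real) ^ 44 \<le> (2 powr (1 / 44)) ^ 44" by (simp add: powr_power)
  then have "(65 / 64 :: real) \<le> 2 powr (1 / 44)" by (rule power_le_imp_le_base[where n=43, simplified]) simp
  then have "(65 / 64 :: real) ^ (5 * M) \<le> (2 powr (1 / 44)) ^ (5 * M)" by (intro power_mono) auto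
  also have "\<dots> = 2 powr (5 / 44 * real M)" by (simp add: powr_power field_simps)
  finally have e3: "(65 / 64 :: real) ^ (5 * M) \<le> 2 powr (5 / 44 * real M)" .
  have "real N ^ Suc (14 * M div (3 * q)) * (64 ^ q * (65 / 64) ^ (5 * M)) / 2 ^ M
      \<le> 2 powr (L + 7 / 15 * real M) * (2 powr (6 * real q) * 2 powr (5 / 44 * real M)) / 2 powr real M"
    using e1 e3 unfolding NL e2
    by (intro divide_mono mult_mono) (auto simp: powr_realpow)
  also have "\<dots> = 2 powr (L + 7 / 15 * real M + 6 * real q + 5 / 44 * real M - real M)"
    by (simp only: powr_add powr_diff times_divide_eq_left mult.assoc)
  also have "\<dots> \<le> 2 powr (6 - 2 * L)"
    using q(2) M L unfolding L_def[symmetric] by (intro powr_mono) auto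
  also have "\<dots> = 64 / real N ^ 2"
    by (simp add: NL powr_diff powr_realpow mult.commute)
  finally show ?thesis .
qed

theorem theorem7:
  shows "(\<lambda>N. measure_pmf.prob (random_subset_mod N)
            {A. real (cayley_sum_clique_number (integer_mod_group N) A) \<le> 160 * log 2 (real N)})
         \<longlonglongrightarrow> 1"
proof -
  define good where "good = (\<lambda>N. {A. real (cayley_sum_clique_number (integer_mod_group N) A) \<le> 160 * log 2 (real N)})"
  define err where "err = (\<lambda>N::nat. ((10 * log 2 (real N) + 1) ^ 2 + 1) * (64 / real N ^ 2))"
  have "1 - err N \<le> measure_pmf.prob (random_subset_mod N) (good N)"
    if L: "1250 \<le> log 2 (real N)" for N
  proof -
    have N: "1 < N"
    proof (rule ccontr)
      assume "\<not> 1 < N"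
      then have "N = 0 \<or> N = 1" by auto
      then show False using L by (auto simp: log_def)
    qed
    define q where "q = nat \<lceil>10 * log 2 (real N)\<rceil>"
    define n where "n = nat \<lceil>80 * log 2 (real N)\<rceil>"
    define m where "m = nat \<lceil>152 * log 2 (real N)\<rceil>"
    have q: "10 * log 2 (real N) \<le> real q" "real q \<le> 10 * log 2 (real N) + 1"
      and n: "80 * log 2 (real N) \<le> real n" "real n < 80 * log 2 (real N) + 1"
      and m: "152 * log 2 (real N) \<le> real m" "real m < 152 * log 2 (real N) + 1"
      unfolding q_def n_def m_def using L by linarith+
    have "- good N \<subseteq> {A. \<exists>Y \<in> certificates N q m. sums_mod N Y \<subseteq> A}"
    proof
      fix A assume "A \<in> - good N"
      then have "160 * log 2 (real N) < real (cayley_sum_clique_number (integer_mod_group N) A)"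
        by (simp add: good_def)
      then have "2 * n \<le> cayley_sum_clique_number (integer_mod_group N) A + 1"
        using n(2) by linarith
      moreover have "100000 \<le> n" "n \<le> 10 * q" "q \<le> n" using n q L by linarith+
      moreover have "10 * m \<le> 19 * n + 9" using n m by linarith
      ultimately show "A \<in> {A. \<exists>Y \<in> certificates N q m. sums_mod N Y \<subseteq> A}"
        using large_clique_has_certificate[of N n q m A] N by auto
    qed
    then have "measure_pmf.prob (random_subset_mod N) (- good N)
        \<le> measure_pmf.prob (random_subset_mod N) {A. \<exists>Y \<in> certificates N q m. sums_mod N Y \<subseteq> A}"
      by (intro measure_pmf.finite_measure_mono) auto
    also have "\<dots> \<le> (real q ^ 2 + 1) * (64 / real N ^ 2)"
    proof (rule prob_contains_certificate_le)
      show "0 < q" using q L by linarith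
      show "real N ^ Suc (14 * M div (3 * q)) * (64 ^ q * (65 / 64) ^ (5 * M)) / 2 ^ M \<le> 64 / real N ^ 2"
        if "m \<le> M" for M
        using that m by (intro certificate_term_le N q) linarith
    qed (use N in auto)
    also have "\<dots> \<le> err N"
      unfolding err_def using q by (intro mult_right_mono add_right_mono power_mono) auto
    finally have "measure_pmf.prob (random_subset_mod N) (- good N) \<le> err N" .
    then show ?thesis
      using measure_pmf.prob_compl[of "good N" "random_subset_mod N"] by (simp add: Compl_eq_Diff_UNIV)
  qed
  moreover have "eventually (\<lambda>N::nat. 1250 \<le> log 2 (real N)) sequentially" by real_asymp
  ultimately have lower: "eventually (\<lambda>N. 1 - err N \<le> measure_pmf.prob (random_subset_mod N) (good N)) sequentially"
    by (auto elim: eventually_mono)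
  have "err \<longlonglongrightarrow> 0" unfolding err_def by real_asymp
  then have "(\<lambda>N. 1 - err N) \<longlonglongrightarrow> 1 - 0" by (intro tendsto_diff tendsto_const)
  then have "(\<lambda>N. 1 - err N) \<longlonglongrightarrow> 1" by simp
  from tendsto_sandwich[OF lower _ this tendsto_const[of 1]]
  show ?thesis by (simp add: good_def)
qed

end
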